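(* Let $1\le q\le2$ and $p\ge2$, and let $\gamma>1$ be a constant. If $(\mathcal{S},f)$ is a $(k,\gamma)$-sketching family for the $q\to p$ norm of $n\times n$ real matrices, then $k=\Omega(n/\log n)$.
   Context: $\|A\|_{q\to p}=\sup_{x\ne0}\frac{\|Ax\|_p}{\|x\|_q}$. A $(k,\alpha)$-sketching family for the $q\to p$ norm is a pair $(\mathcal{S},f)$ where $\mathcal{S}$ is a distribution over linear maps $L:\mathbb{R}^{n\times n}\to\mathbb{R}^k$ and $f:\mathbb{R}^k\to\mathbb{R}$, such that for every $A$, $\Pr_{L\sim\mathcal{S}}\big[f(L(A))\in(\tfrac1\alpha\|A\|_{q\to p},\,\alpha\|A\|_{q\to p})\big]\ge \frac56$. *)

theory Defs
  imports "HOL-Probability.Probability" "Jordan_Normal_Form.Matrix"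
begin

hide_type (open) Finite_Cartesian_Product.vec
no_notation vec_nth (infixl \<open>$\<close> 90)

text \<open>The exponent is an extended real so that the exponent \<open>\<infinity>\<close> is covered.\<close>

definition lp_norm :: "ereal \<Rightarrow> real Matrix.vec \<Rightarrow> real" where
  "lp_norm p x =
     (if p = \<infinity> then Max (insert 0 ((\<lambda>i. \<bar>x $ i\<bar>) ` {..<dim_vec x}))
      else (\<Sum>i<dim_vec x. \<bar>x $ i\<bar> powr real_of_ereal p) powr (1 / real_of_ereal p))"

definition op_norm :: "ereal \<Rightarrow> ereal \<Rightarrow> real mat \<Rightarrow> real" where
  "op_norm q p A =
     (SUP x \<in> carrier_vec (dim_col A) - {0\<^sub>v (dim_col A)}. lp_norm p (A *\<^sub>v x) / lp_norm q x)"

definition linear_maps :: "nat \<Rightarrow> nat \<Rightarrow> (real mat \<Rightarrow> real Matrix.vec) set" where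
  "linear_maps n k =
     {L \<in> carrier_mat n n \<rightarrow>\<^sub>E carrier_vec k.
        (\<forall>A\<in>carrier_mat n n. \<forall>B\<in>carrier_mat n n. L (A + B) = L A + L B) \<and>
        (\<forall>c. \<forall>A\<in>carrier_mat n n. L (c \<cdot>\<^sub>m A) = c \<cdot>\<^sub>v L A)}"

text \<open>The sigma-algebra generated by all the coordinates of all the evaluations \<open>L \<mapsto> L A\<close>.
  It is the Borel sigma-algebra of the finite-dimensional space of linear maps.\<close>

definition linear_maps_borel :: "nat \<Rightarrow> nat \<Rightarrow> (real mat \<Rightarrow> real Matrix.vec) measure" where
  "linear_maps_borel n k =
     sigma (linear_maps n k)
       {{L \<in> linear_maps n k. L A $ i \<in> U} | A i U.
          A \<in> carrier_mat n n \<and> i < k \<and> U \<in> sets borel}"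

text \<open>The matrix \<open>A = 0\<close> is exempted: there the open interval is empty, so including it would
  leave no sketching families at all.  No measurability of \<open>f\<close> is assumed separately: the
  \<^const>\<open>measure\<close> of a set outside \<open>sets S\<close> is 0, so the inequality entails that the event
  is measurable.\<close>

definition sketching_family ::
  "nat \<Rightarrow> nat \<Rightarrow> real \<Rightarrow> ereal \<Rightarrow> ereal \<Rightarrow>
   (real mat \<Rightarrow> real Matrix.vec) measure \<Rightarrow> (real Matrix.vec \<Rightarrow> real) \<Rightarrow> bool" where
  "sketching_family n k \<alpha> q p S f \<longleftrightarrow>
     prob_space S \<and> sets S = sets (linear_maps_borel n k) \<and>
     (\<forall>A \<in> carrier_mat n n - {0\<^sub>m n n}.
        measure S {L \<in> space S. f (L A) \<in> {1 / \<alpha> * op_norm q p A <..< \<alpha> * op_norm q p A}} \<ge> 5 / 6)"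

end

theory Submission
  imports Defs
begin

text \<open>
  Diagonal matrices reduce the problem to sketching the maximum norm.  The hard inputs are
  \<open>diag(1, x\<^sub>1, \<dots>, x\<^sub>n\<^sub>-\<^sub>1)\<close> with independent \<open>x\<^sub>i \<in> [-1, 1]\<close>, of norm exactly 1, against the same matrix
  with \<open>s = 1 + \<gamma>\<^sup>2\<close> added to one entry \<open>i\<close>, of norm at least \<open>\<gamma>\<^sup>2\<close>, so that the two admissible
  intervals for \<open>f\<close> are disjoint.  For a fixed sketch \<open>L\<close>, adding \<open>s e\<^sub>i\<close> has the same effect as adding
  \<open>s r\<^sub>i\<close>, where \<open>r\<^sub>i\<close> is the orthogonal projection of \<open>e\<^sub>i\<close> to the row space of \<open>L\<close>.  If the density of the
  \<open>x\<^sub>i\<close> is the square of a Lipschitz function, the Hellinger distance bounds the change of the law of \<open>x\<close>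
  in total variation by \<open>O(s \<bar>r\<^sub>i\<bar>)\<close>.  Since the sum of the \<open>\<bar>r\<^sub>i\<bar>\<^sup>2\<close> is the rank, at most \<open>k\<close>, averaging
  over \<open>i\<close> forces \<open>k = \<Omega>(n)\<close>.  Bounded \<open>x\<^sub>i\<close>, instead of Gaussian ones, avoid the loss of \<open>log n\<close>.
\<close>

section \<open>Orthogonal projections\<close>

text \<open>Gram-Schmidt by induction on \<open>k\<close>: \<open>P\<close> is the matrix of the
  orthogonal projection onto the span of the vectors \<open>l a\<close>. Each new vector adds at
  most one rank-one term of trace 1, so the trace stays below \<open>k\<close>.\<close>

lemma exists_orthogonal_projection:
  fixes l :: "nat \<Rightarrow> 'i \<Rightarrow> real"
  assumes I: "finite I"
  shows "\<exists>P. (\<forall>i\<in>I. \<forall>j\<in>I. P i j = P j i)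
           \<and> (\<forall>i\<in>I. \<forall>j\<in>I. (\<Sum>h\<in>I. P i h * P h j) = P i j)
           \<and> (\<forall>a<k. \<forall>i\<in>I. (\<Sum>j\<in>I. P i j * l a j) = l a i)
           \<and> (\<Sum>i\<in>I. P i i) \<le> real k"
proof (induction k)
  case 0
  show ?case by (rule exI[of _ "\<lambda>i j. 0"]) simp
next
  case (Suc k)
  then obtain P where sym: "\<And>i j. i \<in> I \<Longrightarrow> j \<in> I \<Longrightarrow> P i j = P j i"
    and idem: "\<And>i j. i \<in> I \<Longrightarrow> j \<in> I \<Longrightarrow> (\<Sum>h\<in>I. P i h * P h j) = P i j"
    and fixes_l: "\<And>a i. a < k \<Longrightarrow> i \<in> I \<Longrightarrow> (\<Sum>j\<in>I. P i j * l a j) = l a i"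
    and tr: "(\<Sum>i\<in>I. P i i) \<le> real k"
    by blast
  \<comment> \<open>The residual of the new vector \<open>l k\<close>. If it vanishes,
    \<open>l k\<close> already lies in the range of \<open>P\<close>, and the old projection still
    works; otherwise the projection onto the line of \<open>w\<close> is added.\<close>
  define w where "w i = l k i - (\<Sum>j\<in>I. P i j * l k j)" for i
  define N where "N = (\<Sum>i\<in>I. w i ^ 2)"
  show ?case
  proof (cases "N = 0")
    case True
    then have "w i = 0" if "i \<in> I" for i
      using that I unfolding N_def by (simp add: sum_nonneg_eq_0_iff)
    then have "(\<Sum>j\<in>I. P i j * l k j) = l k i" if "i \<in> I" for i
      using that by (simp add: w_def)
    then show ?thesis
      using sym idem fixes_l tr by (intro exI[of _ P]) (auto simp: less_Suc_eq)
  next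
    case N: False
    define Q where "Q i j = P i j + w i * w j / N" for i j
    have Pw: "(\<Sum>j\<in>I. P i j * w j) = 0" if i: "i \<in> I" for i
    proof -
      have "(\<Sum>j\<in>I. P i j * (\<Sum>h\<in>I. P j h * l k h)) = (\<Sum>j\<in>I. \<Sum>h\<in>I. P i j * P j h * l k h)"
        by (simp add: sum_distrib_left mult.assoc)
      also have "\<dots> = (\<Sum>h\<in>I. (\<Sum>j\<in>I. P i j * P j h) * l k h)"
        by (subst sum.swap) (simp add: sum_distrib_right)
      also have "\<dots> = (\<Sum>h\<in>I. P i h * l k h)"
        using i idem by simp
      finally show ?thesis
        by (simp add: w_def right_diff_distrib sum_subtractf)
    qed
    have wP: "(\<Sum>h\<in>I. w h * P h j) = 0" if "j \<in> I" for j
      using Pw[OF that] sym[OF that] by (simp add: mult.commute)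
    \<comment> \<open>\<open>w\<close> is orthogonal to the whole range of \<open>P\<close>. This
      covers the earlier vectors, which \<open>P\<close> fixes, and also the part of
      \<open>l k\<close> inside the range.\<close>
    have w_fixed: "(\<Sum>j\<in>I. w j * (\<Sum>h\<in>I. P j h * v h)) = 0" for v
    proof -
      have "(\<Sum>j\<in>I. w j * (\<Sum>h\<in>I. P j h * v h)) = (\<Sum>j\<in>I. \<Sum>h\<in>I. w j * P j h * v h)"
        by (simp add: sum_distrib_left mult.assoc)
      also have "\<dots> = (\<Sum>h\<in>I. (\<Sum>j\<in>I. w j * P j h) * v h)"
        by (subst sum.swap) (simp add: sum_distrib_right)
      finally show ?thesis
        using wP by simp
    qed
    have wl: "(\<Sum>j\<in>I. w j * l a j) = 0" if "a < k" for a
    proof -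
      have "(\<Sum>j\<in>I. w j * l a j) = (\<Sum>j\<in>I. w j * (\<Sum>h\<in>I. P j h * l a h))"
        using fixes_l[OF that] by (intro sum.cong) auto
      then show ?thesis
        using w_fixed by simp
    qed
    have "(\<Sum>j\<in>I. w j * l k j) = (\<Sum>j\<in>I. w j * (w j + (\<Sum>h\<in>I. P j h * l k h)))"
      by (simp add: w_def)
    also have "\<dots> = N"
      using w_fixed[of "l k"] by (simp add: distrib_left sum.distrib N_def power2_eq_square)
    finally have wlk: "(\<Sum>j\<in>I. w j * l k j) = N" .
    have Ql: "(\<Sum>j\<in>I. Q i j * l a j) = (\<Sum>j\<in>I. P i j * l a j) + w i * (\<Sum>j\<in>I. w j * l a j) / N" for i a
      by (simp add: Q_def distrib_right sum.distrib sum_distrib_left sum_divide_distrib mult.assoc)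
    have "(\<Sum>h\<in>I. Q i h * Q h j) = Q i j" if "i \<in> I" "j \<in> I" for i j
    proof -
      \<comment> \<open>The cross terms vanish because \<open>P\<close> kills \<open>w\<close> from
        either side, and the rank-one term reproduces itself because \<open>N\<close> is the squared
        length of \<open>w\<close>.\<close>
      have "(\<Sum>h\<in>I. Q i h * Q h j) = (\<Sum>h\<in>I. P i h * P h j + (P i h * w h) * (w j / N)
              + (w i / N) * (w h * P h j) + (w i * w j / (N * N)) * (w h)\<^sup>2)"
        using N by (intro sum.cong) (simp_all add: Q_def field_simps power2_eq_square)
      also have "\<dots> = (\<Sum>h\<in>I. P i h * P h j) + (\<Sum>h\<in>I. P i h * w h) * (w j / N)
              + (w i / N) * (\<Sum>h\<in>I. w h * P h j) + (w i * w j / (N * N)) * N"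
        unfolding N_def by (simp only: sum.distrib sum_distrib_left sum_distrib_right)
      finally show ?thesis
        using that N by (simp add: idem Pw wP Q_def)
    qed
    moreover have "(\<Sum>i\<in>I. Q i i) \<le> real (Suc k)"
    proof -
      have "(\<Sum>i\<in>I. Q i i) = (\<Sum>i\<in>I. P i i) + (\<Sum>i\<in>I. (w i)\<^sup>2) / N"
        by (simp only: Q_def sum.distrib power2_eq_square sum_divide_distrib)
      then show ?thesis
        using tr N by (simp flip: N_def)
    qed
    moreover have "(\<Sum>j\<in>I. Q i j * l a j) = l a i" if "a < Suc k" "i \<in> I" for a i
      using that N w_def[of i] by (auto simp: less_Suc_eq Ql fixes_l wl wlk)
    ultimately show ?thesis
      using sym by (intro exI[of _ Q]) (auto simp: Q_def mult.commute)
  qed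
qed

text \<open>Take the rows of the projection. By symmetry and idempotence the squared length of row
  \<open>i\<close> is the diagonal entry \<open>P i i\<close>, so the total is the trace. Row
  \<open>i\<close> cannot be told apart from the unit vector at \<open>i\<close> by any of the
  functionals \<open>l a\<close>.\<close>

lemma exists_short_representatives:
  fixes l :: "nat \<Rightarrow> 'i \<Rightarrow> real"
  assumes "finite I"
  obtains r where "\<And>a i. a < k \<Longrightarrow> i \<in> I \<Longrightarrow> (\<Sum>j\<in>I. r i j * l a j) = l a i"
    and "(\<Sum>i\<in>I. \<Sum>j\<in>I. (r i j)\<^sup>2) \<le> real k"
proof -
  obtain P where sym: "\<And>i j. i \<in> I \<Longrightarrow> j \<in> I \<Longrightarrow> P i j = P j i"
    and idem: "\<And>i j. i \<in> I \<Longrightarrow> j \<in> I \<Longrightarrow> (\<Sum>h\<in>I. P i h * P h j) = P i j"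
    and fixes_l: "\<And>a i. a < k \<Longrightarrow> i \<in> I \<Longrightarrow> (\<Sum>j\<in>I. P i j * l a j) = l a i"
    and tr: "(\<Sum>i\<in>I. P i i) \<le> real k"
    using exists_orthogonal_projection[OF assms, of k l] by blast
  have "(\<Sum>j\<in>I. (P i j)\<^sup>2) = P i i" if "i \<in> I" for i
  proof -
    have "(\<Sum>j\<in>I. (P i j)\<^sup>2) = (\<Sum>j\<in>I. P i j * P j i)"
      using that sym by (intro sum.cong) (auto simp: power2_eq_square)
    then show ?thesis
      using that idem by simp
  qed
  then have "(\<Sum>i\<in>I. \<Sum>j\<in>I. (P i j)\<^sup>2) \<le> real k"
    using tr by simp
  with fixes_l show ?thesis
    by (rule that)
qed

section \<open>Operator norms of diagonal matrices\<close>

lemma lp_norm_nonneg: "0 \<le> lp_norm p x"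
  by (auto simp: lp_norm_def intro: Max_ge)

lemma lp_norm_power:
  assumes "1 \<le> q" "q \<noteq> \<infinity>"
  shows "lp_norm q x powr real_of_ereal q = (\<Sum>i<dim_vec x. \<bar>x $ i\<bar> powr real_of_ereal q)"
proof -
  have "real_of_ereal q \<ge> 1"
    using assms by (cases q) auto
  then show ?thesis
    using assms by (simp add: lp_norm_def powr_powr sum_nonneg)
qed

lemma abs_entry_le_lp_norm:
  assumes "1 \<le> q" "i < dim_vec x"
  shows "\<bar>x $ i\<bar> \<le> lp_norm q x"
proof (cases "q = \<infinity>")
  case True
  then show ?thesis
    using assms by (auto simp: lp_norm_def intro: Max_ge)
next
  case False
  then have q: "real_of_ereal q \<ge> 1"
    using assms by (cases q) auto
  have "\<bar>x $ i\<bar> powr real_of_ereal q \<le> lp_norm q x powr real_of_ereal q"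
    unfolding lp_norm_power[OF assms(1) False] using assms by (intro member_le_sum) auto
  then show ?thesis
    using q lp_norm_nonneg[of q x] by (smt (verit) powr_less_mono2)
qed

lemma lp_norm_pos:
  assumes "1 \<le> q" "x \<in> carrier_vec n - {0\<^sub>v n}"
  shows "0 < lp_norm q x"
proof -
  obtain i where i: "i < dim_vec x" "x $ i \<noteq> 0"
    using assms by (metis DiffE carrier_vecD eq_vecI index_zero_vec insertI1)
  then show ?thesis
    using abs_entry_le_lp_norm[OF assms(1) i(1)] by linarith
qed

text \<open>Monotonicity of the norms in the exponent, with an entrywise factor so that it applies
  directly to diagonal matrices. For finite \<open>p\<close>, each entry of \<open>y\<close> is at
  most the norm \<open>N\<close>, hence \<open>P - Q\<close> of the \<open>P\<close> powers can be
  traded for powers of \<open>N\<close>.\<close>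

lemma lp_norm_le_mult:
  assumes pq: "1 \<le> q" "q \<le> p" and d: "dim_vec x = dim_vec y"
    and b: "0 \<le> b" and le: "\<And>i. i < dim_vec x \<Longrightarrow> \<bar>x $ i\<bar> \<le> b * \<bar>y $ i\<bar>"
  shows "lp_norm p x \<le> b * lp_norm q y"
proof (cases "p = \<infinity>")
  case True
  have "\<bar>x $ i\<bar> \<le> b * lp_norm q y" if "i < dim_vec x" for i
    using le[OF that] abs_entry_le_lp_norm[of q i y] mult_left_mono[of "\<bar>y $ i\<bar>" "lp_norm q y" b] that b d pq
    by simp
  then show ?thesis
    using True b lp_norm_nonneg[of q y] by (auto simp: lp_norm_def)
next
  case False
  have q: "q \<noteq> \<infinity>"
    using pq False by (cases q; cases p) auto
  define P where "P = real_of_ereal p"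
  define Q where "Q = real_of_ereal q"
  have PQ: "1 \<le> Q" "Q \<le> P"
    using pq False q unfolding P_def Q_def by (cases q; cases p; simp)+
  define N where "N = lp_norm q y"
  have N: "0 \<le> N"
    by (simp add: N_def lp_norm_nonneg)
  have "(\<Sum>i<dim_vec x. \<bar>x $ i\<bar> powr P) \<le> (\<Sum>i<dim_vec y. b powr P * (N powr (P - Q) * \<bar>y $ i\<bar> powr Q))"
    unfolding d
  proof (rule sum_mono)
    fix i assume "i \<in> {..<dim_vec y}"
    then have i: "i < dim_vec y" by simp
    have yN: "\<bar>y $ i\<bar> \<le> N"
      unfolding N_def using abs_entry_le_lp_norm[OF pq(1) i] .
    have "\<bar>x $ i\<bar> powr P \<le> (b * \<bar>y $ i\<bar>) powr P"
      using le[of i] i d PQ by (intro powr_mono2) auto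
    also have "\<dots> = b powr P * (\<bar>y $ i\<bar> powr (P - Q) * \<bar>y $ i\<bar> powr Q)"
      using b by (simp add: powr_mult flip: powr_add)
    also have "\<dots> \<le> b powr P * (N powr (P - Q) * \<bar>y $ i\<bar> powr Q)"
      using yN PQ by (intro mult_left_mono mult_right_mono powr_mono2) auto
    finally show "\<bar>x $ i\<bar> powr P \<le> b powr P * (N powr (P - Q) * \<bar>y $ i\<bar> powr Q)" .
  qed
  also have "\<dots> = b powr P * (N powr (P - Q) * N powr Q)"
    using lp_norm_power[OF pq(1) q, of y] by (simp add: N_def Q_def sum_distrib_left)
  also have "\<dots> = (b * N) powr P"
    using b N by (simp add: powr_mult flip: powr_add)
  finally have *: "(\<Sum>i<dim_vec x. \<bar>x $ i\<bar> powr P) \<le> (b * N) powr P" .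
  have "lp_norm p x = (\<Sum>i<dim_vec x. \<bar>x $ i\<bar> powr P) powr (1 / P)"
    using False by (simp add: lp_norm_def P_def)
  also have "\<dots> \<le> ((b * N) powr P) powr (1 / P)"
    using * PQ by (intro powr_mono2) (auto simp: sum_nonneg)
  also have "\<dots> = b * N"
    using PQ b N by (simp add: powr_powr)
  finally show ?thesis
    by (simp add: N_def)
qed

lemma lp_norm_unit_vec:
  assumes "1 \<le> p" "i < n"
  shows "lp_norm p (unit_vec n i) = 1"
proof (rule antisym)
  have "\<bar>unit_vec n i $ i\<bar> \<le> lp_norm p (unit_vec n i :: real Matrix.vec)"
    using assms by (intro abs_entry_le_lp_norm) auto
  then show "1 \<le> lp_norm p (unit_vec n i)"
    using assms by simp
  show "lp_norm p (unit_vec n i) \<le> 1"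
  proof (cases "p = \<infinity>")
    case True
    then show ?thesis
      by (auto simp: lp_norm_def unit_vec_def)
  next
    case False
    have "(\<Sum>j<n. \<bar>unit_vec n i $ j :: real\<bar> powr real_of_ereal p) = (\<Sum>j<n. if j = i then 1 else 0)"
      using assms by (intro sum.cong) (auto simp: unit_vec_def)
    then have "(\<Sum>j<n. \<bar>unit_vec n i $ j :: real\<bar> powr real_of_ereal p) = 1"
      using assms by simp
    then show ?thesis
      using False unfolding lp_norm_def index_unit_vec(3) by simp
  qed
qed

lemma mat_diag_mult_vec:
  fixes d :: "nat \<Rightarrow> real"
  assumes "x \<in> carrier_vec n"
  shows "mat_diag n d *\<^sub>v x = Matrix.vec n (\<lambda>i. d i * x $ i)"
proof (rule eq_vecI)
  fix i assume "i < dim_vec (Matrix.vec n (\<lambda>i. d i * x $ i))"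
  then have i: "i < n" by simp
  have "(mat_diag n d *\<^sub>v x) $ i = (\<Sum>j\<in>{0..<n}. (if i = j then d j else 0) * x $ j)"
    using i assms by (simp add: mat_diag_def scalar_prod_def)
  also have "\<dots> = (\<Sum>j\<in>{0..<n}. if j = i then d j * x $ j else 0)"
    by (rule sum.cong) auto
  finally show "(mat_diag n d *\<^sub>v x) $ i = Matrix.vec n (\<lambda>i. d i * x $ i) $ i"
    using i by simp
qed (simp add: mat_diag_def)

lemma dim_mat_diag [simp]: "dim_row (mat_diag n d) = n" "dim_col (mat_diag n d) = n"
  by (simp_all add: mat_diag_def)

lemma lp_norm_mat_diag_le:
  assumes pq: "1 \<le> q" "q \<le> p" and b: "0 \<le> b" "\<And>i. i < n \<Longrightarrow> \<bar>d i\<bar> \<le> b"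
    and x: "x \<in> carrier_vec n - {0\<^sub>v n}"
  shows "lp_norm p (mat_diag n d *\<^sub>v x) / lp_norm q x \<le> b"
proof -
  have "lp_norm p (mat_diag n d *\<^sub>v x) \<le> b * lp_norm q x"
    using x b by (intro lp_norm_le_mult[OF pq]) (auto simp: mat_diag_mult_vec abs_mult intro!: mult_right_mono)
  then show ?thesis
    using lp_norm_pos[OF pq(1) x] by (simp add: field_simps)
qed

lemma op_norm_mat_diag_le:
  assumes "1 \<le> q" "q \<le> p" "0 < n" "\<And>i. i < n \<Longrightarrow> \<bar>d i\<bar> \<le> b"
  shows "op_norm q p (mat_diag n d) \<le> b"
  unfolding op_norm_def dim_mat_diag
proof (rule cSUP_least)
  \<comment> \<open>A bound on the elements passes to the supremum only over a nonempty set, so a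
    nonzero vector has to be exhibited; this uses \<open>0 < n\<close>.\<close>
  have "unit_vec n 0 \<in> carrier_vec n - {0\<^sub>v n :: real Matrix.vec}"
    using assms(3) by (auto dest: arg_cong[of _ _ "\<lambda>v. v $ 0"])
  then show "carrier_vec n - {0\<^sub>v n :: real Matrix.vec} \<noteq> {}" by blast
  have "0 \<le> b" using assms(3,4) abs_ge_zero order_trans by blast
  then show "lp_norm p (mat_diag n d *\<^sub>v x) / lp_norm q x \<le> b"
    if "x \<in> carrier_vec n - {0\<^sub>v n}" for x
    using assms that by (intro lp_norm_mat_diag_le) auto
qed

lemma op_norm_mat_diag_ge:
  assumes pq: "1 \<le> q" "q \<le> p" and i: "i < n"
  shows "\<bar>d i\<bar> \<le> op_norm q p (mat_diag n d)"
proof -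
  \<comment> \<open>A crude bound on all the entries. It serves only to show that the set of
    quotients is bounded above, so that its supremum dominates the value at the unit vector.\<close>
  define b where "b = (\<Sum>j<n. \<bar>d j\<bar>)"
  have b: "0 \<le> b" "\<And>j. j < n \<Longrightarrow> \<bar>d j\<bar> \<le> b"
    by (auto simp: b_def sum_nonneg intro: member_le_sum)
  have e: "unit_vec n i \<in> carrier_vec n - {0\<^sub>v n :: real Matrix.vec}"
    using i by (auto dest: arg_cong[of _ _ "\<lambda>v. v $ i"])
  have "\<bar>d i\<bar> = \<bar>(mat_diag n d *\<^sub>v unit_vec n i) $ i\<bar>"
    using i by (simp add: mat_diag_mult_vec)
  also have "\<dots> \<le> lp_norm p (mat_diag n d *\<^sub>v unit_vec n i)"
    using i pq by (intro abs_entry_le_lp_norm) auto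
  also have "\<dots> = lp_norm p (mat_diag n d *\<^sub>v unit_vec n i) / lp_norm q (unit_vec n i)"
    using lp_norm_unit_vec[OF pq(1) i] by simp
  also have "\<dots> \<le> op_norm q p (mat_diag n d)"
    unfolding op_norm_def dim_mat_diag
    by (rule cSUP_upper[OF e]) (auto intro!: bdd_aboveI2[of _ _ b] lp_norm_mat_diag_le[OF pq b])
  finally show ?thesis .
qed

lemma op_norm_mat_diag_eq:
  assumes "1 \<le> q" "q \<le> p" "i < n" "\<And>j. j < n \<Longrightarrow> \<bar>d j\<bar> \<le> \<bar>d i\<bar>"
  shows "op_norm q p (mat_diag n d) = \<bar>d i\<bar>"
  using op_norm_mat_diag_le[of q p n d "\<bar>d i\<bar>"] op_norm_mat_diag_ge[of q p i n d] assms by force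

section \<open>A product measure that is stable under translations\<close>

text \<open>The square root of the density of one coordinate. The integral of
  \<open>(1 - x^2)^2\<close> over [-1, 1] is 16/15, which gives the constant; cutting off at 0
  leaves a Lipschitz function supported in [-1, 1].\<close>

definition bump :: "real \<Rightarrow> real" where
  "bump x = sqrt (15 / 16) * max 0 (1 - x\<^sup>2)"

lemma bump_nonneg: "0 \<le> bump x"
  by (simp add: bump_def)

lemma bump_eq_0: "1 < \<bar>x\<bar> \<Longrightarrow> bump x = 0"
  using abs_square_le_1[of x] by (simp add: bump_def)

lemma bump_measurable [measurable]: "bump \<in> borel_measurable borel"
  unfolding bump_def[abs_def] by measurable

lemma bump_square: "(bump x)\<^sup>2 = 15 / 16 * (1 - x\<^sup>2)\<^sup>2 * indicator {-1..1} x"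
proof (cases "\<bar>x\<bar> \<le> 1")
  case True
  then have "x\<^sup>2 \<le> 1"
    by (simp add: abs_square_le_1)
  with True show ?thesis
    by (auto simp: bump_def power_mult_distrib indicator_def)
next
  case False
  then show ?thesis
    by (auto simp: bump_eq_0 indicator_def)
qed

lemma has_bochner_integral_bump_square: "has_bochner_integral lborel (\<lambda>x. (bump x)\<^sup>2) 1"
proof -
  define F :: "real \<Rightarrow> real" where "F x = 15 / 16 * (x - 2 * x ^ 3 / 3 + x ^ 5 / 5)" for x
  have "has_bochner_integral lborel (\<lambda>x. 15 / 16 * (1 - x\<^sup>2)\<^sup>2 * indicator {-1..1} x) (F 1 - F (-1))"
  proof (rule has_bochner_integral_FTC_Icc_real)
    fix x :: real
    show "DERIV F x :> 15 / 16 * (1 - x\<^sup>2)\<^sup>2"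
      unfolding F_def by (auto intro!: derivative_eq_intros simp: power2_eq_square power4_eq_xxxx algebra_simps)
  qed (auto intro!: continuous_intros)
  then show ?thesis
    by (simp add: bump_square F_def)
qed

lemma
  shows integrable_bump_shift: "integrable lborel (\<lambda>x. (bump (x - t))\<^sup>2)"
    and integral_bump_shift: "(\<integral>x. (bump (x - t))\<^sup>2 \<partial>lborel) = 1"
  using has_bochner_integral_bump_square
    lborel_integrable_real_affine[of "\<lambda>x. (bump x)\<^sup>2" 1 "-t"]
    lborel_integral_real_affine[of 1 "\<lambda>x. (bump x)\<^sup>2" "-t"]
  by (simp_all add: has_bochner_integral_iff)

lemma integrable_bump_mult: "integrable lborel (\<lambda>x. bump (x - s) * bump (x - t))"
proof (rule Bochner_Integration.integrable_bound)
  show "integrable lborel (\<lambda>x. (bump (x - s))\<^sup>2 + (bump (x - t))\<^sup>2)"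
    by (intro Bochner_Integration.integrable_add integrable_bump_shift)
  show "AE x in lborel. norm (bump (x - s) * bump (x - t)) \<le> norm ((bump (x - s))\<^sup>2 + (bump (x - t))\<^sup>2)"
  proof (rule AE_I2)
    fix x
    have "2 * (bump (x - s) * bump (x - t)) \<le> (bump (x - s))\<^sup>2 + (bump (x - t))\<^sup>2"
      using sum_squares_bound[of "bump (x - s)" "bump (x - t)"] by simp
    then show "norm (bump (x - s) * bump (x - t)) \<le> norm ((bump (x - s))\<^sup>2 + (bump (x - t))\<^sup>2)"
      using mult_nonneg_nonneg[OF bump_nonneg bump_nonneg, of "x - s" "x - t"]
      unfolding real_norm_def by linarith
  qed
qed measurable

lemma bump_lipschitz: "\<bar>bump x - bump y\<bar> \<le> sqrt (15 / 16) * (2 * \<bar>x - y\<bar>)"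
proof -
  \<comment> \<open>One point inside and one outside the support: \<open>1 - x^2\<close> is at most
    twice the distance of \<open>x\<close> from the boundary of [-1, 1], and the outer point is at
    least that far away.\<close>
  have out: "1 - x\<^sup>2 \<le> 2 * \<bar>x - y\<bar>" if "\<bar>x\<bar> \<le> 1" "1 \<le> \<bar>y\<bar>" for x y :: real
  proof -
    have "1 - x\<^sup>2 = (1 + \<bar>x\<bar>) * (1 - \<bar>x\<bar>)"
      by (simp add: algebra_simps flip: power2_eq_square)
    also have "\<dots> \<le> 2 * (1 - \<bar>x\<bar>)"
      using that by (intro mult_right_mono) auto
    finally show ?thesis
      using that abs_triangle_ineq2[of y x] by (simp add: abs_minus_commute)
  qed
  have both: "\<bar>x\<^sup>2 - y\<^sup>2\<bar> \<le> 2 * \<bar>x - y\<bar>" if "\<bar>x\<bar> \<le> 1" "\<bar>y\<bar> \<le> 1"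
  proof -
    have "\<bar>x\<^sup>2 - y\<^sup>2\<bar> = \<bar>x + y\<bar> * \<bar>x - y\<bar>"
      by (simp add: power2_eq_square algebra_simps flip: abs_mult)
    then show ?thesis
      using that by (auto intro!: mult_right_mono)
  qed
  have "\<bar>max 0 (1 - x\<^sup>2) - max 0 (1 - y\<^sup>2)\<bar> \<le> 2 * \<bar>x - y\<bar>"
    using out[of x y] out[of y x] both abs_square_le_1[of x] abs_square_le_1[of y]
    by (cases "\<bar>x\<bar> \<le> 1"; cases "\<bar>y\<bar> \<le> 1") (auto simp: max_def abs_if split: if_splits)
  then show ?thesis
    unfolding bump_def right_diff_distrib[symmetric] abs_mult by (simp add: mult_left_mono)
qed

text \<open>The Hellinger affinity (Bhattacharyya coefficient) of the density and its translate by
  \<open>t\<close>.\<close>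

definition bump_overlap :: "real \<Rightarrow> real" where
  "bump_overlap t = (\<integral>x. bump x * bump (x - t) \<partial>lborel)"

lemma integral_bump_diff_square:
  "(\<integral>x. (bump x - bump (x - t))\<^sup>2 \<partial>lborel) = 2 - 2 * bump_overlap t"
  using integrable_bump_shift[of 0] integrable_bump_shift[of t] integrable_bump_mult[of 0 t]
    integral_bump_shift[of 0] integral_bump_shift[of t]
  by (simp add: power2_diff bump_overlap_def mult.assoc)

lemma bump_overlap_nonneg: "0 \<le> bump_overlap t"
  by (simp add: bump_overlap_def bump_nonneg)

lemma bump_overlap_le_1: "bump_overlap t \<le> 1"
proof -
  have "0 \<le> (\<integral>x. (bump x - bump (x - t))\<^sup>2 \<partial>lborel)"
    by simp
  then show ?thesis
    by (simp add: integral_bump_diff_square)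
qed

text \<open>The squared difference is at most \<open>15/4 * t^2\<close> by the Lipschitz bound and
  vanishes off the two supports, each of length 2. Its integral is thus at most
  \<open>15 * t^2\<close>; half of that, 7.5, is rounded up to 8.\<close>

lemma bump_overlap_ge: "1 - 8 * t\<^sup>2 \<le> bump_overlap t"
proof -
  let ?J = "indicator {-1..1} :: real \<Rightarrow> real" and ?Jt = "indicator {t-1..t+1} :: real \<Rightarrow> real"
  have "(\<integral>x. (bump x - bump (x - t))\<^sup>2 \<partial>lborel) \<le> (\<integral>x. 15 / 4 * t\<^sup>2 * (?J x + ?Jt x) \<partial>lborel)"
  proof (rule integral_mono)
    show "integrable lborel (\<lambda>x. (bump x - bump (x - t))\<^sup>2)"
      using integrable_bump_shift[of 0] integrable_bump_shift[of t] integrable_bump_mult[of 0 t]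
      by (simp add: power2_diff mult.assoc)
    show "integrable lborel (\<lambda>x. 15 / 4 * t\<^sup>2 * (?J x + ?Jt x))"
      by (intro integrable_mult_right Bochner_Integration.integrable_add) auto
    fix x
    show "(bump x - bump (x - t))\<^sup>2 \<le> 15 / 4 * t\<^sup>2 * (?J x + ?Jt x)"
    proof (cases "x \<in> {-1..1} \<or> x \<in> {t-1..t+1}")
      case True
      have "(bump x - bump (x - t))\<^sup>2 \<le> (sqrt (15 / 16) * (2 * \<bar>t\<bar>))\<^sup>2"
        using bump_lipschitz[of x "x - t"] by (intro power2_le_iff_abs_le[THEN iffD2]) auto
      also have "\<dots> = 15 / 4 * t\<^sup>2 * 1"
        by (simp add: power_mult_distrib)
      also have "\<dots> \<le> 15 / 4 * t\<^sup>2 * (?J x + ?Jt x)"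
        using True by (intro mult_left_mono) (auto simp: indicator_def)
      finally show ?thesis .
    next
      case False
      then have "1 < \<bar>x\<bar>" "1 < \<bar>x - t\<bar>"
        by auto
      then show ?thesis
        by (simp add: bump_eq_0)
    qed
  qed
  also have "\<dots> = 15 * t\<^sup>2"
  proof -
    have "integrable lborel ?J" "integrable lborel ?Jt"
      by auto
    then show ?thesis
      by simp
  qed
  finally have "2 - 2 * bump_overlap t \<le> 15 * t\<^sup>2"
    by (simp add: integral_bump_diff_square)
  then show ?thesis
    using zero_le_power2[of t] by linarith
qed

section \<open>The product density and its translates\<close>

interpretation lborel_product: product_sigma_finite "\<lambda>_ :: 'i. lborel :: real measure"
  by standard

lemma distr_PiM_lborel_translate:
  fixes c :: "'i \<Rightarrow> real"
  assumes "finite I"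
  shows "distr (PiM I (\<lambda>_. lborel)) (PiM I (\<lambda>_. lborel)) (\<lambda>x. \<lambda>i\<in>I. x i + c i) = PiM I (\<lambda>_. lborel)"
proof (rule lborel_product.PiM_eqI)
  fix A :: "'i \<Rightarrow> real set" assume A: "\<And>i. i \<in> I \<Longrightarrow> A i \<in> sets lborel"
  have "emeasure (distr (PiM I (\<lambda>_. lborel)) (PiM I (\<lambda>_. lborel)) (\<lambda>x. \<lambda>i\<in>I. x i + c i)) (PiE I A)
      = emeasure (PiM I (\<lambda>_. lborel))
          ((\<lambda>x. \<lambda>i\<in>I. x i + c i) -` PiE I A \<inter> space (PiM I (\<lambda>_. lborel)))"
    using A assms by (intro emeasure_distr) (auto intro!: sets_PiM_I_finite)
  also have "(\<lambda>x. \<lambda>i\<in>I. x i + c i) -` PiE I A \<inter> space (PiM I (\<lambda>_. lborel))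
      = (\<Pi>\<^sub>E i\<in>I. (\<lambda>x. x + c i) -` A i)"
    by (auto simp: space_PiM PiE_def Pi_def extensional_def)
  also have "emeasure (PiM I (\<lambda>_. lborel)) \<dots> = (\<Prod>i\<in>I. emeasure lborel ((\<lambda>x. x + c i) -` A i))"
  proof (rule lborel_product.emeasure_PiM[OF assms])
    fix i assume "i \<in> I"
    then show "(\<lambda>x. x + c i) -` A i \<in> sets lborel"
      using A measurable_sets[of "\<lambda>x. x + c i" borel borel "A i"] by simp
  qed
  also have "\<dots> = (\<Prod>i\<in>I. emeasure lborel (A i))"
  proof (intro prod.cong refl)
    fix i assume "i \<in> I"
    have "emeasure lborel (A i) = emeasure (distr lborel borel ((+) (c i))) (A i)"
      by (simp add: lborel_distr_plus)
    also have "\<dots> = emeasure lborel ((\<lambda>x. x + c i) -` A i)"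
      using A[OF \<open>i \<in> I\<close>] by (subst emeasure_distr) (auto simp: vimage_def add.commute)
    finally show "emeasure lborel ((\<lambda>x. x + c i) -` A i) = emeasure lborel (A i)" ..
  qed
  finally show "emeasure (distr (PiM I (\<lambda>_. lborel)) (PiM I (\<lambda>_. lborel)) (\<lambda>x. \<lambda>i\<in>I. x i + c i)) (PiE I A)
      = (\<Prod>i\<in>I. emeasure lborel (A i))" .
qed (use assms in auto)

text \<open>The law of independent coordinates with density \<open>bump\<close> squared. The square
  stands outside the product, so that the square root of the joint density is at hand for the
  Hellinger argument.\<close>

definition bump_measure :: "'i set \<Rightarrow> ('i \<Rightarrow> real) measure" where
  "bump_measure I = density (PiM I (\<lambda>_. lborel)) (\<lambda>x. ennreal ((\<Prod>i\<in>I. bump (x i))\<^sup>2))"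

lemma sets_bump_measure [measurable_cong, simp]: "sets (bump_measure I) = sets (PiM I (\<lambda>_. lborel))"
  by (simp add: bump_measure_def)

lemma space_bump_measure [simp]: "space (bump_measure I) = space (PiM I (\<lambda>_. lborel))"
  by (simp add: bump_measure_def)

lemma has_bochner_integral_bump_prod:
  fixes c :: "'i \<Rightarrow> real"
  assumes "finite I"
  shows "has_bochner_integral (PiM I (\<lambda>_. lborel)) (\<lambda>x. (\<Prod>i\<in>I. bump (x i - c i))\<^sup>2) 1"
  using lborel_product.product_integrable_prod[OF assms, of "\<lambda>i x. (bump (x - c i))\<^sup>2"]
    lborel_product.product_integral_prod[OF assms, of "\<lambda>i x. (bump (x - c i))\<^sup>2"]
  by (simp add: has_bochner_integral_iff prod_power_distrib integrable_bump_shift integral_bump_shift)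

lemma prob_space_bump_measure:
  assumes "finite I"
  shows "prob_space (bump_measure I)"
proof (rule prob_spaceI)
  have "emeasure (bump_measure I) (space (bump_measure I))
      = (\<integral>\<^sup>+x. ennreal ((\<Prod>i\<in>I. bump (x i))\<^sup>2) \<partial>PiM I (\<lambda>_. lborel))"
    by (auto simp: bump_measure_def emeasure_density intro!: nn_integral_cong)
  also have "\<dots> = 1"
    using has_bochner_integral_bump_prod[OF assms, of "\<lambda>_. 0"]
    by (subst nn_integral_eq_integral) (auto simp: has_bochner_integral_iff)
  finally show "emeasure (bump_measure I) (space (bump_measure I)) = 1" .
qed

text \<open>The density is zero as soon as one coordinate leaves [-1, 1]. Hence the unshifted hard
  input almost surely has operator norm exactly 1.\<close>

lemma AE_bump_measure:
  assumes "finite I"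
  shows "AE x in bump_measure I. \<forall>i\<in>I. \<bar>x i\<bar> \<le> 1"
  unfolding bump_measure_def
proof (subst AE_density)
  have "(\<forall>i\<in>I. \<bar>x i\<bar> \<le> 1)" if "0 < ennreal ((\<Prod>i\<in>I. bump (x i))\<^sup>2)" for x :: "'a \<Rightarrow> real"
  proof (rule ccontr)
    assume "\<not> (\<forall>i\<in>I. \<bar>x i\<bar> \<le> 1)"
    then obtain i where "i \<in> I" "bump (x i) = 0"
      using bump_eq_0 by force
    then have "(\<Prod>i\<in>I. bump (x i)) = 0"
      using assms by auto
    with that show False by simp
  qed
  then show "AE x in PiM I (\<lambda>_. lborel). 0 < ennreal ((\<Prod>i\<in>I. bump (x i))\<^sup>2) \<longrightarrow> (\<forall>i\<in>I. \<bar>x i\<bar> \<le> 1)"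
    by auto
qed measurable

text \<open>With \<open>f\<^sup>2\<close> and \<open>g\<^sup>2\<close> the two densities and \<open>A\<close> the integral of \<open>f g\<close>, Young's inequality for
  \<open>f\<^sup>2 - g\<^sup>2 = (f - g) (f + g)\<close> replaces Cauchy-Schwarz; it keeps the bound linear in the sum of the squares.\<close>

lemma bump_measure_translate_le:
  fixes c :: "'i \<Rightarrow> real"
  assumes I: "finite I" and h [measurable]: "h \<in> borel_measurable (PiM I (\<lambda>_. lborel))"
    and h01: "\<And>x. 0 \<le> h x" "\<And>x. h x \<le> 1" and e: "0 < e"
  shows "(\<integral>x. h x \<partial>bump_measure I) - (\<integral>x. h (\<lambda>i\<in>I. x i + c i) \<partial>bump_measure I)
    \<le> 8 * (\<Sum>i\<in>I. (c i)\<^sup>2) / e + 2 * e"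
proof -
  let ?M = "PiM I (\<lambda>_. lborel :: real measure)"
  define f where "f x = (\<Prod>i\<in>I. bump (x i))" for x :: "'i \<Rightarrow> real"
  define g where "g x = (\<Prod>i\<in>I. bump (x i - c i))" for x :: "'i \<Rightarrow> real"
  define A where "A = (\<Prod>i\<in>I. bump_overlap (c i))"
  have [measurable]: "f \<in> borel_measurable ?M" "g \<in> borel_measurable ?M"
    unfolding f_def g_def by measurable
  have f2: "integrable ?M (\<lambda>x. (f x)\<^sup>2)" "(\<integral>x. (f x)\<^sup>2 \<partial>?M) = 1"
    using has_bochner_integral_bump_prod[OF I, of "\<lambda>_. 0"] by (auto simp: f_def has_bochner_integral_iff)
  have g2: "integrable ?M (\<lambda>x. (g x)\<^sup>2)" "(\<integral>x. (g x)\<^sup>2 \<partial>?M) = 1"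
    using has_bochner_integral_bump_prod[OF I, of c] by (auto simp: g_def has_bochner_integral_iff)
  have fg: "integrable ?M (\<lambda>x. f x * g x)" "(\<integral>x. f x * g x \<partial>?M) = A"
    using lborel_product.product_integrable_prod[OF I, of "\<lambda>i x. bump x * bump (x - c i)"]
      lborel_product.product_integral_prod[OF I, of "\<lambda>i x. bump x * bump (x - c i)"]
      integrable_bump_mult[of 0]
    by (auto simp: f_def g_def A_def bump_overlap_def prod.distrib)
  \<comment> \<open>Affinities multiply over independent coordinates, and the Weierstrass inequality
    for products of factors \<open>1 - a\<close> with \<open>a\<close> in [0, 1] turns the product
    into a bound linear in the sum of squares.\<close>
  have A: "1 - 8 * (\<Sum>i\<in>I. (c i)\<^sup>2) \<le> A" "A \<le> 1"
  proof -
    have "1 - (\<Sum>i\<in>I. 8 * (c i)\<^sup>2) \<le> 1 - (\<Sum>i\<in>I. 1 - bump_overlap (c i))"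
      using bump_overlap_ge by (intro diff_left_mono sum_mono) (simp add: algebra_simps)
    also have "\<dots> \<le> (\<Prod>i\<in>I. 1 - (1 - bump_overlap (c i)))"
      by (intro Weierstrass_prod_ineq) (auto simp: bump_overlap_nonneg bump_overlap_le_1)
    finally show "1 - 8 * (\<Sum>i\<in>I. (c i)\<^sup>2) \<le> A"
      by (simp add: A_def sum_distrib_left)
    show "A \<le> 1"
      unfolding A_def by (intro prod_le_1) (auto simp: bump_overlap_nonneg bump_overlap_le_1)
  qed
  have int_h: "integrable ?M (\<lambda>x. (u x)\<^sup>2 * h x)"
    if [measurable]: "u \<in> borel_measurable ?M" and "integrable ?M (\<lambda>x. (u x)\<^sup>2)" for u
    using that(2) by (rule Bochner_Integration.integrable_bound)
      (auto simp: abs_mult h01 intro!: mult_left_le)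
  have "(\<integral>x. h x \<partial>bump_measure I) = (\<integral>x. (f x)\<^sup>2 * h x \<partial>?M)"
    unfolding bump_measure_def f_def by (subst integral_density) auto
  \<comment> \<open>Translation invariance of Lebesgue measure moves the shift from the argument of
    \<open>h\<close> to the density.\<close>
  moreover have "(\<integral>x. h (\<lambda>i\<in>I. x i + c i) \<partial>bump_measure I) = (\<integral>x. (g x)\<^sup>2 * h x \<partial>?M)"
  proof -
    have "(\<integral>x. (g x)\<^sup>2 * h x \<partial>?M)
        = (\<integral>x. (g x)\<^sup>2 * h x \<partial>distr ?M ?M (\<lambda>x. \<lambda>i\<in>I. x i + c i))"
      by (simp add: distr_PiM_lborel_translate[OF I])
    also have "\<dots> = (\<integral>x. (g (\<lambda>i\<in>I. x i + c i))\<^sup>2 * h (\<lambda>i\<in>I. x i + c i) \<partial>?M)"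
      by (rule integral_distr) measurable
    also have "\<dots> = (\<integral>x. (f x)\<^sup>2 * h (\<lambda>i\<in>I. x i + c i) \<partial>?M)"
      by (simp add: f_def g_def)
    also have "\<dots> = (\<integral>x. h (\<lambda>i\<in>I. x i + c i) \<partial>bump_measure I)"
      unfolding bump_measure_def f_def by (subst integral_density) auto
    finally show ?thesis ..
  qed
  moreover have "(\<integral>x. (f x)\<^sup>2 * h x \<partial>?M) - (\<integral>x. (g x)\<^sup>2 * h x \<partial>?M)
      = (\<integral>x. ((f x)\<^sup>2 - (g x)\<^sup>2) * h x \<partial>?M)"
    using int_h f2 g2 by (simp add: left_diff_distrib)
  \<comment> \<open>The bound is \<open>(f - g)^2 / (2 * e) + (f + g)^2 * (e / 2)\<close> with the
    squares expanded, so its integral follows from those of \<open>f^2\<close>, \<open>g^2\<close>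
    and \<open>f * g\<close>, which are 1, 1 and \<open>A\<close>.\<close>
  moreover have "\<dots> \<le> (\<integral>x. ((f x)\<^sup>2 + (g x)\<^sup>2 - 2 * (f x * g x)) / (2 * e)
      + ((f x)\<^sup>2 + (g x)\<^sup>2 + 2 * (f x * g x)) * (e / 2) \<partial>?M)"
  proof (rule integral_mono)
    show "integrable ?M (\<lambda>x. ((f x)\<^sup>2 - (g x)\<^sup>2) * h x)"
      using int_h f2 g2 by (simp add: left_diff_distrib)
    show "integrable ?M (\<lambda>x. ((f x)\<^sup>2 + (g x)\<^sup>2 - 2 * (f x * g x)) / (2 * e)
      + ((f x)\<^sup>2 + (g x)\<^sup>2 + 2 * (f x * g x)) * (e / 2))"
      using f2 g2 fg by simp
    fix x
    have *: "2 * (a * b) \<le> a\<^sup>2 / e + b\<^sup>2 * e" for a b :: real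
    proof -
      have "0 \<le> (a - b * e)\<^sup>2 / e"
        using e by simp
      then show ?thesis
        using e by (simp add: power2_eq_square field_simps)
    qed
    have "((f x)\<^sup>2 - (g x)\<^sup>2) * h x \<le> \<bar>(f x)\<^sup>2 - (g x)\<^sup>2\<bar> * h x"
      using h01 by (intro mult_right_mono) auto
    also have "\<dots> \<le> \<bar>(f x)\<^sup>2 - (g x)\<^sup>2\<bar>"
      using h01 by (intro mult_left_le) auto
    also have "\<dots> = \<bar>f x - g x\<bar> * \<bar>f x + g x\<bar>"
      by (simp add: power2_eq_square algebra_simps flip: abs_mult)
    also have "\<dots> \<le> (f x - g x)\<^sup>2 / (2 * e) + (f x + g x)\<^sup>2 * (e / 2)"
      using *[of "\<bar>f x - g x\<bar>" "\<bar>f x + g x\<bar>"] by simp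
    finally show "((f x)\<^sup>2 - (g x)\<^sup>2) * h x
      \<le> ((f x)\<^sup>2 + (g x)\<^sup>2 - 2 * (f x * g x)) / (2 * e)
        + ((f x)\<^sup>2 + (g x)\<^sup>2 + 2 * (f x * g x)) * (e / 2)"
      by (simp add: power2_diff power2_sum mult.assoc)
  qed
  moreover have "\<dots> = (1 + 1 - 2 * A) / (2 * e) + (1 + 1 + 2 * A) * (e / 2)"
    using f2 g2 fg by simp
  moreover have "\<dots> = (1 - A) / e + (1 + A) * e"
    using e by (simp add: field_simps)
  moreover have "\<dots> \<le> 8 * (\<Sum>i\<in>I. (c i)\<^sup>2) / e + 2 * e"
    using A e by (intro add_mono divide_right_mono mult_right_mono) auto
  ultimately show ?thesis
    by linarith
qed

section \<open>Linear sketches of diagonal matrices\<close>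

text \<open>The corner entry pinned to 1 fixes the norm whenever the other entries lie in [-1, 1],
  and it keeps the matrix away from 0, which \<open>sketching_family\<close> exempts.\<close>

definition padded_diag :: "nat \<Rightarrow> (nat \<Rightarrow> real) \<Rightarrow> real mat" where
  "padded_diag n x = mat_diag n (\<lambda>i. if i = 0 then 1 else x i)"

lemma padded_diag_carrier:
  assumes "0 < n"
  shows "padded_diag n x \<in> carrier_mat n n - {0\<^sub>m n n}"
proof -
  have "padded_diag n x $$ (0, 0) \<noteq> 0\<^sub>m n n $$ (0, 0)"
    using assms by (simp add: padded_diag_def mat_diag_def)
  then show ?thesis
    by (auto simp: padded_diag_def)
qed

lemma linear_mapsD:
  assumes "L \<in> linear_maps n k"
  shows "A \<in> carrier_mat n n \<Longrightarrow> L A \<in> carrier_vec k"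
    and "A \<in> carrier_mat n n \<Longrightarrow> B \<in> carrier_mat n n \<Longrightarrow> L (A + B) = L A + L B"
    and "A \<in> carrier_mat n n \<Longrightarrow> L (c \<cdot>\<^sub>m A) = c \<cdot>\<^sub>v L A"
  using assms by (auto simp: linear_maps_def)

lemma linear_map_mat_diag:
  assumes L: "L \<in> linear_maps n k" and a: "a < k"
  shows "L (mat_diag n d) $ a = (\<Sum>i<n. d i * L (mat_diag n (\<lambda>j. if j = i then 1 else 0)) $ a)"
proof -
  let ?E = "\<lambda>i. mat_diag n (\<lambda>j. if j = i then 1 else 0 :: real)"
  let ?D = "\<lambda>m. mat_diag n (\<lambda>i. if i < m then d i else 0)"
  have dim: "dim_vec (L (mat_diag n c)) = k" for c
    using linear_mapsD(1)[OF L mat_diag_dim] by auto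
  have partial: "L (?D m) $ a = (\<Sum>i<m. d i * L (?E i) $ a)" for m
  proof (induction m)
    case 0
    \<comment> \<open>Writing the zero matrix as a multiple by 0 lets homogeneity give the value
      0.\<close>
    have "?D 0 = 0 \<cdot>\<^sub>m mat_diag n d"
      by (rule eq_matI) (auto simp: mat_diag_def)
    then have "L (?D 0) = 0 \<cdot>\<^sub>v L (mat_diag n d)"
      using linear_mapsD(3)[OF L mat_diag_dim, of 0 d] by (simp only:)
    moreover have "(0 \<cdot>\<^sub>v L (mat_diag n d)) $ a = 0"
      using a dim by simp
    ultimately show ?case
      by (simp only: lessThan_0 sum.empty)
  next
    case (Suc m)
    have D_Suc: "?D (Suc m) = ?D m + d m \<cdot>\<^sub>m ?E m"
    proof (rule eq_matI)
      fix i j assume "i < dim_row (?D m + d m \<cdot>\<^sub>m ?E m)" "j < dim_col (?D m + d m \<cdot>\<^sub>m ?E m)"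
      then have ij: "i < n" "j < n" by simp_all
      then show "?D (Suc m) $$ (i, j) = (?D m + d m \<cdot>\<^sub>m ?E m) $$ (i, j)"
        by (simp add: mat_diag_def less_Suc_eq)
    qed simp_all
    have "L (?D m + d m \<cdot>\<^sub>m ?E m) = L (?D m) + L (d m \<cdot>\<^sub>m ?E m)"
      by (rule linear_mapsD(2)[OF L]) simp_all
    then have L_Suc: "L (?D (Suc m)) = L (?D m) + d m \<cdot>\<^sub>v L (?E m)"
      by (simp only: D_Suc linear_mapsD(3)[OF L mat_diag_dim])
    have "(L (?D m) + d m \<cdot>\<^sub>v L (?E m)) $ a = L (?D m) $ a + d m * L (?E m) $ a"
      using a dim by simp
    then show ?case
      by (simp only: L_Suc Suc sum.lessThan_Suc)
  qed
  have D: "?D n = mat_diag n d"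
    by (rule eq_matI) (auto simp: mat_diag_def)
  show ?thesis
    using partial[of n] unfolding D .
qed

lemma linear_map_padded_diag:
  assumes "L \<in> linear_maps n k" "a < k" "0 < n"
  shows "L (padded_diag n x) $ a = L (mat_diag n (\<lambda>j. if j = 0 then 1 else 0)) $ a
    + (\<Sum>i\<in>{1..<n}. x i * L (mat_diag n (\<lambda>j. if j = i then 1 else 0)) $ a)"
proof -
  have *: "{..<n} = insert 0 {1..<n}"
    using assms(3) by auto
  show ?thesis
    unfolding padded_diag_def by (subst linear_map_mat_diag[OF assms(1,2)]) (simp add: *)
qed

lemma op_norm_padded_diag:
  assumes "1 \<le> q" "q \<le> p" "0 < n" "\<And>i. i \<in> {1..<n} \<Longrightarrow> \<bar>x i\<bar> \<le> 1"
  shows "op_norm q p (padded_diag n x) = 1"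
  using op_norm_mat_diag_eq[of q p 0 n "\<lambda>i. if i = 0 then 1 else x i"] assms
  by (simp add: padded_diag_def)

lemma op_norm_padded_diag_ge:
  assumes "1 \<le> q" "q \<le> p" "i \<in> {1..<n}"
  shows "\<bar>x i\<bar> \<le> op_norm q p (padded_diag n x)"
  using op_norm_mat_diag_ge[of q p i n "\<lambda>i. if i = 0 then 1 else x i"] assms
  by (simp add: padded_diag_def)

section \<open>Measurability on the space of sketches\<close>

lemma generators_subset_linear_maps:
  "{{L \<in> linear_maps n k. L A $ i \<in> U} | A i U. A \<in> carrier_mat n n \<and> i < k \<and> U \<in> sets borel}
    \<subseteq> Pow (linear_maps n k)"
  by auto

lemma space_linear_maps_borel: "space (linear_maps_borel n k) = linear_maps n k"
  unfolding linear_maps_borel_def by (rule space_measure_of[OF generators_subset_linear_maps])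

lemma measurable_linear_map_entry:
  assumes "A \<in> carrier_mat n n" "i < k"
  shows "(\<lambda>L. L A $ i) \<in> borel_measurable (linear_maps_borel n k)"
proof (rule measurableI)
  fix U :: "real set" assume U: "U \<in> sets borel"
  have "{L \<in> linear_maps n k. L A $ i \<in> U} \<in> sets (linear_maps_borel n k)"
    unfolding linear_maps_borel_def sets_measure_of[OF generators_subset_linear_maps]
    using assms U by (intro sigma_sets.Basic) blast
  also have "{L \<in> linear_maps n k. L A $ i \<in> U} = (\<lambda>L. L A $ i) -` U \<inter> space (linear_maps_borel n k)"
    by (auto simp: space_linear_maps_borel)
  finally show "(\<lambda>L. L A $ i) -` U \<inter> space (linear_maps_borel n k) \<in> sets (linear_maps_borel n k)" .
qed simp

lemma measurable_into_linear_maps_borel: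
  assumes "\<And>z. z \<in> space M \<Longrightarrow> F z \<in> linear_maps n k"
    and "\<And>A i. A \<in> carrier_mat n n \<Longrightarrow> i < k \<Longrightarrow> (\<lambda>z. F z A $ i) \<in> borel_measurable M"
  shows "F \<in> measurable M (linear_maps_borel n k)"
  unfolding linear_maps_borel_def
proof (rule measurable_measure_of[OF generators_subset_linear_maps])
  show "F \<in> space M \<rightarrow> linear_maps n k"
    using assms(1) by auto
next
  fix Y assume "Y \<in> {{L \<in> linear_maps n k. L A $ i \<in> U} | A i U.
    A \<in> carrier_mat n n \<and> i < k \<and> U \<in> sets borel}"
  then obtain A i U where Y: "Y = {L \<in> linear_maps n k. L A $ i \<in> U}"
    and *: "A \<in> carrier_mat n n" "i < k" "U \<in> sets borel"
    by blast
  have "F -` Y \<inter> space M = (\<lambda>z. F z A $ i) -` U \<inter> space M"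
    using assms(1) by (auto simp: Y)
  then show "F -` Y \<inter> space M \<in> sets M"
    using measurable_sets[OF assms(2)[OF *(1,2)] *(3)] by simp
qed

text \<open>The function \<open>f\<close> is not assumed measurable, so joint measurability of \<open>(L, x) \<mapsto> f (L A\<^sub>x)\<close> is not
  given.  The map below sends \<open>(L, x)\<close> to a sketch whose value at the fixed matrix \<open>A\<^sub>0\<close> is \<open>L A\<^sub>x\<close>, which
  pulls it back from the measurability of the single event for \<open>A\<^sub>0\<close>.\<close>

definition corner_map :: "nat \<Rightarrow> real Matrix.vec \<Rightarrow> real mat \<Rightarrow> real Matrix.vec" where
  "corner_map n v = (\<lambda>A\<in>carrier_mat n n. A $$ (0, 0) \<cdot>\<^sub>v v)"

lemma corner_map_linear:
  assumes "0 < n" "v \<in> carrier_vec k"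
  shows "corner_map n v \<in> linear_maps n k"
  using assms by (auto simp: linear_maps_def corner_map_def add_smult_distrib_vec smult_smult_assoc)

lemma corner_map_padded_diag:
  assumes "0 < n"
  shows "corner_map n v (padded_diag n x) = v"
  using assms by (auto simp: corner_map_def padded_diag_def) (auto simp: mat_diag_def)

text \<open>By linearity, every coordinate of every evaluation is a finite sum of products of
  entries of \<open>x\<close> with values of \<open>L\<close> at diagonal matrix units, and these
  are jointly measurable.\<close>

lemma measurable_corner_map_padded_diag:
  assumes n: "0 < n" and S: "sets S = sets (linear_maps_borel n k)"
  shows "(\<lambda>z. corner_map n (fst z (padded_diag n (snd z))))
    \<in> measurable (S \<Otimes>\<^sub>M PiM {1..<n} (\<lambda>_. lborel)) S"
proof -
  let ?M = "S \<Otimes>\<^sub>M PiM {1..<n} (\<lambda>_. lborel :: real measure)"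
  let ?E = "\<lambda>i. mat_diag n (\<lambda>j. if j = i then 1 else 0 :: real)"
  have space_S: "space S = linear_maps n k"
    using sets_eq_imp_space_eq[OF S] unfolding space_linear_maps_borel .
  have sp: "fst z \<in> linear_maps n k" if "z \<in> space ?M" for z
    using that unfolding space_pair_measure space_S by auto
  have "(\<lambda>z. corner_map n (fst z (padded_diag n (snd z)))) \<in> measurable ?M (linear_maps_borel n k)"
  proof (rule measurable_into_linear_maps_borel)
    show "corner_map n (fst z (padded_diag n (snd z))) \<in> linear_maps n k" if "z \<in> space ?M" for z
      using sp[OF that] n padded_diag_carrier[OF n] by (intro corner_map_linear linear_mapsD) auto
    fix A :: "real mat" and i assume A: "A \<in> carrier_mat n n" and i: "i < k"
    have [measurable]: "(\<lambda>L. L (?E j) $ i) \<in> borel_measurable S" for j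
      using measurable_linear_map_entry[OF mat_diag_dim i] measurable_cong_sets[OF S refl] by blast
    have "(\<lambda>z. A $$ (0, 0) * (fst z (?E 0) $ i + (\<Sum>j\<in>{1..<n}. snd z j * fst z (?E j) $ i)))
        \<in> borel_measurable ?M"
      by measurable
    also have "?this \<longleftrightarrow> (\<lambda>z. corner_map n (fst z (padded_diag n (snd z))) A $ i) \<in> borel_measurable ?M"
    proof (rule measurable_cong)
      fix z assume "z \<in> space ?M"
      note L = sp[OF this]
      have "fst z (padded_diag n (snd z)) \<in> carrier_vec k"
        using linear_mapsD(1)[OF L] padded_diag_carrier[OF n] by blast
      then show "A $$ (0, 0) * (fst z (?E 0) $ i + (\<Sum>j\<in>{1..<n}. snd z j * fst z (?E j) $ i))
          = corner_map n (fst z (padded_diag n (snd z))) A $ i"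
        using A i by (simp add: corner_map_def linear_map_padded_diag[OF L i n])
    qed
    finally show "(\<lambda>z. corner_map n (fst z (padded_diag n (snd z))) A $ i) \<in> borel_measurable ?M" .
  qed
  then show ?thesis
    using measurable_cong_sets[OF refl S] by blast
qed

section \<open>The lower bound on the sketching dimension\<close>

lemma sketching_dimension_ge:
  assumes sk: "sketching_family n k \<gamma> q p S f" and \<gamma>: "1 < \<gamma>" and q: "1 \<le> q" and qp: "q \<le> p"
    and n: "0 < n"
  shows "real (n - 1) \<le> 144 * (1 + \<gamma>\<^sup>2)\<^sup>2 * real k"
proof -
  define I where "I = {1..<n}"
  have I: "finite I" by (simp add: I_def)
  define \<mu> where "\<mu> = bump_measure I"
  define s where "s = 1 + \<gamma>\<^sup>2"
  \<comment> \<open>The test that accepts when \<open>f\<close> falls into the interval admissible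
    for norm 1.\<close>
  define h :: "(real mat \<Rightarrow> real Matrix.vec) \<Rightarrow> (nat \<Rightarrow> real) \<Rightarrow> real" where
    "h L x = indicator {y. f y \<in> {1 / \<gamma><..<\<gamma>}} (L (padded_diag n x))" for L x
  define T where "T i x = (\<lambda>j\<in>I. x j + s * (if j = i then 1 else 0))" for i and x :: "nat \<Rightarrow> real"
  have sets_S: "sets S = sets (linear_maps_borel n k)"
    and S: "prob_space S"
    and sk': "\<And>A. A \<in> carrier_mat n n - {0\<^sub>m n n} \<Longrightarrow> 5 / 6 \<le>
      measure S {L \<in> space S. f (L A) \<in> {1 / \<gamma> * op_norm q p A <..< \<gamma> * op_norm q p A}}"
    using sk by (auto simp: sketching_family_def)
  have sets_\<mu> [measurable_cong]: "sets \<mu> = sets (PiM I (\<lambda>_. lborel))"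
    by (simp add: \<mu>_def)
  interpret S: prob_space S by (rule S)
  interpret \<mu>: prob_space \<mu> unfolding \<mu>_def by (rule prob_space_bump_measure[OF I])
  interpret pair_prob_space S \<mu> ..
  \<comment> \<open>A set outside the sigma-algebra has \<open>measure\<close> 0, so a positive
    lower bound forces measurability.\<close>
  have sets_of_prob: "B \<in> sets S" if "5 / 6 \<le> measure S B" for B
    using that measure_notin_sets[of B S] by fastforce
  have space_S: "space S = linear_maps n k"
    using sets_eq_imp_space_eq[OF sets_S] unfolding space_linear_maps_borel .

  \<comment> \<open>The acceptance event at one fixed matrix of norm 1. Composing its indicator with
    the corner map yields \<open>h\<close> as a jointly measurable function.\<close>
  define G where "G = {L \<in> space S. f (L (padded_diag n (\<lambda>_. 0))) \<in> {1 / \<gamma><..<\<gamma>}}"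
  have [measurable]: "G \<in> sets S"
    using sk'[OF padded_diag_carrier[OF n], of "\<lambda>_. 0"] n
    by (intro sets_of_prob) (simp add: G_def op_norm_padded_diag[OF q qp])
  have corner: "(\<lambda>z. corner_map n (fst z (padded_diag n (snd z)))) \<in> measurable (S \<Otimes>\<^sub>M \<mu>) S"
    using measurable_corner_map_padded_diag[OF n sets_S, folded I_def]
      measurable_cong_sets[OF sets_pair_measure_cong[OF refl sets_\<mu>] refl] by blast
  have "(\<lambda>z. indicator G (corner_map n (fst z (padded_diag n (snd z)))) :: real) \<in> borel_measurable (S \<Otimes>\<^sub>M \<mu>)"
    using measurable_compose[OF corner, of "indicator G" borel] by simp
  also have "?this \<longleftrightarrow> (\<lambda>z. h (fst z) (snd z)) \<in> borel_measurable (S \<Otimes>\<^sub>M \<mu>)"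
  proof (rule measurable_cong)
    fix z assume "z \<in> space (S \<Otimes>\<^sub>M \<mu>)"
    then have "corner_map n (fst z (padded_diag n (snd z))) \<in> space S"
      using measurable_space[OF corner] by blast
    then show "indicator G (corner_map n (fst z (padded_diag n (snd z)))) = h (fst z) (snd z)"
      by (simp add: G_def h_def indicator_def corner_map_padded_diag[OF n])
  qed
  finally have h_meas [measurable]: "(\<lambda>z. h (fst z) (snd z)) \<in> borel_measurable (S \<Otimes>\<^sub>M \<mu>)" .
  have h01: "0 \<le> h L x" "h L x \<le> 1" for L x
    by (auto simp: h_def indicator_def)
  have T_meas [measurable]: "T i \<in> measurable \<mu> \<mu>" for i
    unfolding T_def by measurable
  have hT_meas [measurable]: "(\<lambda>z. h (fst z) (T i (snd z))) \<in> borel_measurable (S \<Otimes>\<^sub>M \<mu>)" for i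
  proof -
    have "(\<lambda>z. (fst z, T i (snd z))) \<in> measurable (S \<Otimes>\<^sub>M \<mu>) (S \<Otimes>\<^sub>M \<mu>)"
      by measurable
    from measurable_compose[OF this h_meas] show ?thesis
      by simp
  qed
  have int_h: "integrable (S \<Otimes>\<^sub>M \<mu>) (\<lambda>(L, x). h L x)"
    using h_meas h01 by (intro P.integrable_const_bound[of _ 1]) (auto simp: case_prod_beta')
  have int_hT: "integrable (S \<Otimes>\<^sub>M \<mu>) (\<lambda>(L, x). h L (T i x))" for i
    using hT_meas h01 by (intro P.integrable_const_bound[of _ 1]) (auto simp: case_prod_beta')

  have accept_prob: "(\<integral>L. h L x \<partial>S) = measure S {L \<in> space S. f (L (padded_diag n x)) \<in> {1 / \<gamma><..<\<gamma>}}" for x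
  proof -
    have "(\<integral>L. h L x \<partial>S) = (\<integral>L. indicator {L \<in> space S. f (L (padded_diag n x)) \<in> {1 / \<gamma><..<\<gamma>}} L \<partial>S)"
      by (intro Bochner_Integration.integral_cong) (auto simp: h_def indicator_def)
    then show ?thesis
      by (simp add: Int_absorb2 Collect_restrict)
  qed
  have AE_supp: "AE x in \<mu>. \<forall>i\<in>I. \<bar>x i\<bar> \<le> 1"
    unfolding \<mu>_def by (rule AE_bump_measure[OF I])
  have ge: "5 / 6 \<le> (\<integral>x. \<integral>L. h L x \<partial>S \<partial>\<mu>)"
  proof (rule \<mu>.integral_ge_const)
    show "integrable \<mu> (\<lambda>x. \<integral>L. h L x \<partial>S)"
      using integrable_snd[OF int_h] .
    show "AE x in \<mu>. 5 / 6 \<le> (\<integral>L. h L x \<partial>S)"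
      using AE_supp
    proof eventually_elim
      case (elim x)
      then have "op_norm q p (padded_diag n x) = 1"
        by (intro op_norm_padded_diag[OF q qp n]) (auto simp: I_def)
      then show ?case
        using sk'[OF padded_diag_carrier[OF n], of x] by (simp add: accept_prob)
    qed
  qed
  have le: "(\<integral>x. \<integral>L. h L (T i x) \<partial>S \<partial>\<mu>) \<le> 1 / 6" if i: "i \<in> I" for i
  proof (rule \<mu>.integral_le_const)
    show "integrable \<mu> (\<lambda>x. \<integral>L. h L (T i x) \<partial>S)"
      using integrable_snd[OF int_hT] .
    show "AE x in \<mu>. (\<integral>L. h L (T i x) \<partial>S) \<le> 1 / 6"
      using AE_supp
    proof eventually_elim
      case (elim x)
      let ?A = "padded_diag n (T i x)"
      let ?B = "{L \<in> space S. f (L ?A) \<in> {1 / \<gamma> * op_norm q p ?A <..< \<gamma> * op_norm q p ?A}}"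
      \<comment> \<open>Since \<open>x i\<close> is at least -1, adding
        \<open>s = 1 + \<gamma>\<^sup>2\<close> leaves at least \<open>\<gamma>\<^sup>2\<close>. The
        admissible interval then starts at or above \<gamma>, so a correct answer is rejected by the
        test.\<close>
      have "\<gamma>\<^sup>2 \<le> T i x i"
        using elim i by (force simp: T_def s_def)
      also have "\<dots> \<le> op_norm q p ?A"
        using op_norm_padded_diag_ge[OF q qp, of i n "T i x"] i by (simp add: I_def)
      finally have "1 / \<gamma> * \<gamma>\<^sup>2 \<le> 1 / \<gamma> * op_norm q p ?A"
        using \<gamma> by (intro mult_left_mono) auto
      then have "\<gamma> \<le> 1 / \<gamma> * op_norm q p ?A"
        using \<gamma> by (simp add: power2_eq_square)
      then have sub: "{L \<in> space S. f (L ?A) \<in> {1 / \<gamma><..<\<gamma>}} \<subseteq> space S - ?B"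
        by auto
      have B: "5 / 6 \<le> measure S ?B"
        by (rule sk'[OF padded_diag_carrier[OF n]])
      note B_sets = sets_of_prob[OF B]
      have "measure S {L \<in> space S. f (L ?A) \<in> {1 / \<gamma><..<\<gamma>}} \<le> measure S (space S - ?B)"
        using B_sets by (intro S.finite_measure_mono sub) auto
      also have "\<dots> \<le> 1 / 6"
        using B S.prob_compl[OF B_sets] by simp
      finally show ?case
        by (simp add: accept_prob)
    qed
  qed

  let ?D = "\<lambda>i L. (\<integral>x. h L x \<partial>\<mu>) - (\<integral>x. h L (T i x) \<partial>\<mu>)"
  have int_D: "integrable S (?D i)" for i
    using integrable_fst[OF int_h] integrable_fst[OF int_hT] by (intro Bochner_Integration.integrable_diff) auto
  have D_ge: "2 / 3 \<le> (\<integral>L. ?D i L \<partial>S)" if i: "i \<in> I" for i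
  proof -
    have "(\<integral>L. ?D i L \<partial>S) = (\<integral>L. \<integral>x. h L x \<partial>\<mu> \<partial>S) - (\<integral>L. \<integral>x. h L (T i x) \<partial>\<mu> \<partial>S)"
      using integrable_fst[OF int_h] integrable_fst[OF int_hT] by (intro Bochner_Integration.integral_diff) auto
    also have "\<dots> = (\<integral>x. \<integral>L. h L x \<partial>S \<partial>\<mu>) - (\<integral>x. \<integral>L. h L (T i x) \<partial>S \<partial>\<mu>)"
      using Fubini_integral[OF int_h] Fubini_integral[OF int_hT[of i]] by simp
    finally show ?thesis
      using ge le[OF i] by simp
  qed

  have D_le: "(\<Sum>i\<in>I. ?D i L) \<le> 48 * s\<^sup>2 * real k + real (card I) / 3" if L: "L \<in> space S" for L
  proof -
    have L': "L \<in> linear_maps n k"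
      using L by (simp add: space_S)
    \<comment> \<open>On diagonal matrices, coordinate \<open>a\<close> of the sketch is the
      functional whose coefficients are its values at the diagonal units. The representatives depend
      on \<open>L\<close>, but the bound on their total squared length does not.\<close>
    obtain r where r: "\<And>a i. a < k \<Longrightarrow> i \<in> I \<Longrightarrow>
          (\<Sum>j\<in>I. r i j * L (mat_diag n (\<lambda>l. if l = j then 1 else 0)) $ a)
          = L (mat_diag n (\<lambda>l. if l = i then 1 else 0)) $ a"
      and r_le: "(\<Sum>i\<in>I. \<Sum>j\<in>I. (r i j)\<^sup>2) \<le> real k"
      using exists_short_representatives[OF I, of k "\<lambda>a j. L (mat_diag n (\<lambda>l. if l = j then 1 else 0)) $ a"]
      by blast
    \<comment> \<open>The choice \<open>e = 1/6\<close> makes the additive error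
      \<open>2 * e = 1/3\<close>, half of the gap 2/3, and gives the constant
      \<open>8 / e = 48\<close>.\<close>
    have "?D i L \<le> 8 * (\<Sum>j\<in>I. (s * r i j)\<^sup>2) / (1 / 6) + 2 * (1 / 6)" if i: "i \<in> I" for i
    proof -
      \<comment> \<open>The two inputs differ from \<open>x\<close> by \<open>s\<close> times the
        unit vector at \<open>i\<close> and by \<open>s\<close> times \<open>r i\<close>, which
        \<open>L\<close> does not distinguish. The large shift may thus be replaced by the short one
        for this \<open>L\<close>.\<close>
      have same_sketch: "L (padded_diag n (T i x)) = L (padded_diag n (\<lambda>j\<in>I. x j + s * r i j))" for x
      proof (rule eq_vecI)
        have dim: "dim_vec (L (padded_diag n y)) = k" for y
          using linear_mapsD(1)[OF L'] padded_diag_carrier[OF n] by fastforce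
        then show "dim_vec (L (padded_diag n (T i x))) = dim_vec (L (padded_diag n (\<lambda>j\<in>I. x j + s * r i j)))"
          by simp
        fix a assume "a < dim_vec (L (padded_diag n (\<lambda>j\<in>I. x j + s * r i j)))"
        then have a: "a < k" by (simp add: dim)
        let ?l = "\<lambda>j. L (mat_diag n (\<lambda>l. if l = j then 1 else 0)) $ a"
        have "(\<Sum>j\<in>I. T i x j * ?l j) = (\<Sum>j\<in>I. x j * ?l j + (if j = i then s * ?l j else 0))"
          by (intro sum.cong) (auto simp: T_def algebra_simps)
        also have "\<dots> = (\<Sum>j\<in>I. x j * ?l j) + s * ?l i"
          using i I by (simp add: sum.distrib)
        also have "\<dots> = (\<Sum>j\<in>I. (\<lambda>j\<in>I. x j + s * r i j) j * ?l j)"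
          unfolding r[OF a i, symmetric]
          by (simp add: sum.distrib sum_distrib_left distrib_right mult.assoc)
        finally show "L (padded_diag n (T i x)) $ a = L (padded_diag n (\<lambda>j\<in>I. x j + s * r i j)) $ a"
          by (simp only: linear_map_padded_diag[OF L' a n] flip: I_def)
      qed
      have "(\<lambda>x. h L x) \<in> borel_measurable \<mu>"
        using measurable_compose[OF measurable_Pair1'[OF L] h_meas] by simp
      then have "(\<lambda>x. h L x) \<in> borel_measurable (PiM I (\<lambda>_. lborel))"
        using measurable_cong_sets[OF sets_\<mu> refl] by blast
      from bump_measure_translate_le[OF I this h01, of "1 / 6" "\<lambda>j. s * r i j"]
      show ?thesis
        by (simp add: \<mu>_def h_def same_sketch)
    qed
    then have "?D i L \<le> 48 * s\<^sup>2 * (\<Sum>j\<in>I. (r i j)\<^sup>2) + 1 / 3" if "i \<in> I" for i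
      using that by (fastforce simp: power_mult_distrib simp flip: sum_distrib_left)
    then have "(\<Sum>i\<in>I. ?D i L) \<le> (\<Sum>i\<in>I. 48 * s\<^sup>2 * (\<Sum>j\<in>I. (r i j)\<^sup>2) + 1 / 3)"
      by (rule sum_mono)
    also have "\<dots> = 48 * s\<^sup>2 * (\<Sum>i\<in>I. \<Sum>j\<in>I. (r i j)\<^sup>2) + real (card I) / 3"
      by (simp add: sum.distrib flip: sum_distrib_left)
    also have "\<dots> \<le> 48 * s\<^sup>2 * real k + real (card I) / 3"
      using r_le by (intro add_right_mono mult_left_mono) auto
    finally show ?thesis .
  qed

  \<comment> \<open>Every \<open>i\<close> contributes at least 5/6 - 1/6 = 2/3 on average over
    \<open>L\<close>. After subtracting the 1/3 per index in \<open>D_le\<close>, a third of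
    \<open>n - 1\<close> remains below \<open>48 * s\<^sup>2 * k\<close>, whence 144.\<close>
  have "real (card I) * (2 / 3) \<le> (\<Sum>i\<in>I. \<integral>L. ?D i L \<partial>S)"
    using D_ge by (intro sum_bounded_below) auto
  also have "\<dots> = (\<integral>L. (\<Sum>i\<in>I. ?D i L) \<partial>S)"
    using int_D by (simp only: Bochner_Integration.integral_sum)
  also have "\<dots> \<le> 48 * s\<^sup>2 * real k + real (card I) / 3"
    using int_D D_le by (intro S.integral_le_const Bochner_Integration.integrable_sum AE_I2)
  finally show ?thesis
    by (simp add: I_def s_def)
qed

theorem theorem4p13:
  fixes \<gamma> :: real
  assumes "\<gamma> > 1"
  shows "\<exists>c>0. \<forall>\<^sub>F n in sequentially.
           \<forall>q p :: ereal. 1 \<le> q \<and> q \<le> 2 \<and> 2 \<le> p \<longrightarrow>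
             (\<forall>k S f. sketching_family n k \<gamma> q p S f \<longrightarrow>
                real k \<ge> c * (real n / ln (real n)))"
proof -
  \<comment> \<open>Twice 144, since \<open>n\<close> is at most \<open>2 * (n - 1)\<close> here.
    The constant depends on \<gamma> alone, not on \<open>q\<close> or \<open>p\<close>.\<close>
  define C where "C = 288 * (1 + \<gamma>\<^sup>2)\<^sup>2"
  have C: "0 < C"
    unfolding C_def by (intro mult_pos_pos zero_less_power add_pos_nonneg) auto
  have "1 / C * (real n / ln (real n)) \<le> real k"
    if n: "3 \<le> n" and q: "1 \<le> q" "q \<le> 2" "2 \<le> p" and sk: "sketching_family n k \<gamma> q p S f"
    for n q p k S f
  proof -
    \<comment> \<open>From \<open>n = 3\<close> on, the logarithm is at least 1, so dividing by it
      only weakens the linear bound.\<close>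
    have "1 = ln (exp 1 :: real)"
      by simp
    also have "\<dots> \<le> ln (real n)"
      using n exp_le by (subst ln_le_cancel_iff) auto
    finally have "real n / ln (real n) \<le> real n / 1"
      by (intro divide_left_mono) auto
    also have "\<dots> \<le> 2 * real (n - 1)"
      using n by (simp add: of_nat_diff)
    also have "\<dots> \<le> C * real k"
      using sketching_dimension_ge[OF sk assms q(1) order_trans[OF q(2,3)]] n by (simp add: C_def)
    finally have "1 / C * (real n / ln (real n)) \<le> 1 / C * (C * real k)"
      using C by (intro mult_left_mono) auto
    then show ?thesis
      using C by simp
  qed
  then show ?thesis
    using C by (intro exI[of _ "1 / C"] conjI eventually_sequentiallyI[of 3]) auto
qed

end
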